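(* Let $\mathcal H$ be finite-dimensional, let $f_i:\mathcal H\to\mathbb R$ be $L_i$-smooth ($L_i>0$) for each $i=1,\dots,m-1$, let $f_m:\mathcal H\to(-\infty,+\infty]$ be a proper closed function, and suppose $\sum_{i=1}^mf_i$ is coercive. Let $\mu\in(0,2)$ and $\lambda,\lambda_1,\dots,\lambda_{m-1}\in(0,+\infty)$ with $\sum_{i=1}^{m-1}\lambda_i=1$. For each $i=1,\dots,m-1$, let $\sigma_i\in[-L_i,0]$ be such that $f_i-\frac{\sigma_i}2\|\cdot\|^2$ is convex, and set $$\bar\gamma_i=\begin{cases}\frac1{L_i}&\text{if }-2\sigma_i<(2-\mu)L_i,\\[2pt] -\frac1{\sigma_i}\left(1-\frac\mu2\right)&\text{otherwise.}\end{cases}$$ Let $\{(x_1^k,\dots,x_{m-1}^k,z_1^k,\dots,z_{m-1}^k,y^k)\}_{k\ge0}$ be generated from an arbitrary initial point $(x_1^0,\dots,x_{m-1}^0)\in\mathcal H^{m-1}$ by $$z_i^k\in\operatorname{prox}_{\frac{\lambda}{\lambda_i}f_i}(x_i^k)\ (i=1,\dots,m-1),\quad y^k\in\operatorname{prox}_{\lambda f_m}\Big(\sum_{i=1}^{m-1}\lambda_i(2z_i^k-x_i^k)\Big),\quad x_i^{k+1}=x_i^k+\mu(y^k-z_i^k)\ (i=1,\dots,m-1),$$ with $\frac{\lambda}{\lambda_i}\in(0,\bar\gamma_i)$ for all $i=1,\dots,m-1$. Then: (i) $\{(x_1^k,\dots,x_{m-1}^k,z_1^k,\dots,z_{m-1}^k,y^k)\}$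 is bounded; (ii) if $z_i^*$ and $y^*$ are accumulation points of $\{z_i^k\}$ and $\{y^k\}$ respectively ($i=1,\dots,m-1$), then $z_i^*,y^*\in\operatorname{zer}\left(\sum_{i=1}^m\partial f_i\right)$.
   Context: $\mathcal H$ is a (finite-dimensional) real Hilbert space, $m\ge2$. $f$ is closed if it is lower semicontinuous. $f$ is $L$-smooth if it is continuously differentiable with $\|\nabla f(x)-\nabla f(y)\|\le L\|x-y\|$ for all $x,y\in\mathcal H$. $\operatorname{prox}_{\gamma f}(x)=\operatorname{argmin}_{w\in\mathcal H}f(w)+\frac1{2\gamma}\|w-x\|^2$ for $\gamma>0$. The (limiting) subdifferential $\partial f(x)$ at $x\in\operatorname{dom}f$ is the set of $z$ for which there are sequences $x^k\to x$ with $f(x^k)\to f(x)$ and $z^k\to z$, $z^k\in\hat\partial f(x^k)$, where $\hat\partial f(x)=\{z:\liminf_{\bar x\to x,\bar x\ne x}\frac{f(\bar x)-f(x)-\langle z,\bar x-x\rangle}{\|\bar x-x\|}\ge0\}$; $\partial f(x)=\emptyset$ if $x\notin\operatorname{dom}f$; for continuously differentiable $f$, $\partial f(x)=\{\nabla f(x)\}$. $\operatorname{zer}A=\{x:0\in A(x)\}$ for a set-valued operator $A$. *)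

theory Defs
  imports "HOL-Analysis.Analysis"
begin

definition dom_ext :: "('a \<Rightarrow> ereal) \<Rightarrow> 'a set" where
  "dom_ext f = {x. f x < \<infinity>}"

definition proper_fun :: "('a \<Rightarrow> ereal) \<Rightarrow> bool" where
  "proper_fun f \<longleftrightarrow> (\<forall>x. f x \<noteq> -\<infinity>) \<and> dom_ext f \<noteq> {}"

text \<open>A closed function is a lower semicontinuous one.\<close>

definition closed_fun :: "('a::topological_space \<Rightarrow> ereal) \<Rightarrow> bool" where
  "closed_fun f \<longleftrightarrow> (\<forall>x. f x \<le> Liminf (at x) f)"

definition coercive :: "('a::real_normed_vector \<Rightarrow> ereal) \<Rightarrow> bool" where
  "coercive f \<longleftrightarrow> (f \<longlongrightarrow> \<infinity>) at_infinity"

definition L_smooth :: "real \<Rightarrow> ('a::real_inner \<Rightarrow> real) \<Rightarrow> bool" where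
  "L_smooth L f \<longleftrightarrow> (\<exists>g. (\<forall>x. GDERIV f x :> g x) \<and> continuous_on UNIV g \<and>
     (\<forall>x y. norm (g x - g y) \<le> L * norm (x - y)))"

definition prox :: "real \<Rightarrow> ('a::real_normed_vector \<Rightarrow> ereal) \<Rightarrow> 'a \<Rightarrow> 'a set" where
  "prox \<gamma> f x =
     {w. is_arg_min (\<lambda>w. f w + ereal (1 / (2 * \<gamma>) * (norm (w - x))\<^sup>2)) (\<lambda>_. True) w}"

text \<open>Both subdifferentials are empty outside the domain. On the domain of a function that never
  takes the value \<open>-\<infinity>\<close>, the subtractions below never meet \<open>\<infinity> - \<infinity>\<close>.\<close>

definition frechet_subdiff :: "('a::real_inner \<Rightarrow> ereal) \<Rightarrow> 'a \<Rightarrow> 'a set" where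
  "frechet_subdiff f x = (if x \<in> dom_ext f
     then {z. 0 \<le> Liminf (at x) (\<lambda>u. (f u - f x - ereal (inner z (u - x))) / ereal (norm (u - x)))}
     else {})"

definition limiting_subdiff :: "('a::real_inner \<Rightarrow> ereal) \<Rightarrow> 'a \<Rightarrow> 'a set" where
  "limiting_subdiff f x = (if x \<in> dom_ext f
     then {z. \<exists>xs zs. xs \<longlonglongrightarrow> x \<and> (\<lambda>k. f (xs k)) \<longlonglongrightarrow> f x \<and> zs \<longlonglongrightarrow> z \<and>
            (\<forall>k::nat. zs k \<in> frechet_subdiff f (xs k))}
     else {})"

definition zer :: "('a \<Rightarrow> 'b::zero set) \<Rightarrow> 'a set" where
  "zer A = {x. 0 \<in> A x}"

definition accumulation_point :: "(nat \<Rightarrow> 'a::topological_space) \<Rightarrow> 'a \<Rightarrow> bool" where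
  "accumulation_point s a \<longleftrightarrow> (\<exists>r. strict_mono r \<and> (s \<circ> r) \<longlonglongrightarrow> a)"

definition gamma_bar :: "real \<Rightarrow> real \<Rightarrow> real \<Rightarrow> real" where
  "gamma_bar \<mu> L \<sigma> = (if - 2 * \<sigma> < (2 - \<mu>) * L then 1 / L else - (1 / \<sigma>) * (1 - \<mu> / 2))"

end

theory Submission
  imports Defs
begin

text \<open>
  Write \<open>\<gamma>\<^sub>i = \<lambda> / \<lambda>\<^sub>i\<close>. The optimality condition of the \<open>i\<close>-th proximal step is
  \<open>x\<^sub>i = z\<^sub>i + \<gamma>\<^sub>i \<nabla>f\<^sub>i(z\<^sub>i)\<close>, so that the iteration can be described by the points \<open>z\<^sub>i\<close> alone, and
  completing squares shows that \<open>y\<^sup>k\<close> minimizes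

    \<open>w \<mapsto> f\<^sub>m(w) + \<Sum>\<^sub>i (f\<^sub>i(z\<^sub>i) + \<langle>\<nabla>f\<^sub>i(z\<^sub>i), w - z\<^sub>i\<rangle> + \<parallel>w - z\<^sub>i\<parallel>\<^sup>2 / (2\<gamma>\<^sub>i))\<close>.

  The minimal value, the Douglas-Rachford envelope, is the Lyapunov function of the method.
  Since \<open>y\<^sup>k\<close> is a competitor in the minimization at step \<open>k + 1\<close>, the envelope decreases at least as
  much as the \<open>m - 1\<close> models do when they are re-centred from \<open>z\<^sub>i\<^sup>k\<close> to \<open>z\<^sub>i\<^sup>k\<^sup>+\<^sup>1\<close> and evaluated at
  \<open>y\<^sup>k\<close>. This separates the problem into one inequality for each smooth function
  (\<open>prox_linear_model_decrease\<close>). Up to the factor \<open>2\<gamma>\<mu>\<close> the change of one model is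
  \<open>2\<gamma>\<mu> D + (2 - \<mu>)\<parallel>\<Delta>z\<parallel>\<^sup>2 - 2\<parallel>\<gamma> \<Delta>\<nabla>f\<parallel>\<^sup>2\<close> with the Bregman distance \<open>D\<close>, and the sharp lower bound
  for \<open>D\<close> in terms of \<open>L\<close> and \<open>\<sigma>\<close> turns it into a quadratic form whose worst cases are the two
  extreme curvatures \<open>L\<close> and \<open>\<sigma>\<close>. It is positive there precisely because \<open>\<gamma>L < 1\<close> and
  \<open>-\<gamma>\<sigma> < 1 - \<mu>/2\<close>, and these two inequalities are what the bound on the step size encodes.

  Because \<open>\<gamma>\<^sub>i L\<^sub>i < 1\<close>, the envelope lies above the objective at \<open>y\<^sup>k\<close>. Coercivity therefore bounds
  \<open>y\<^sup>k\<close>, the envelope converges, and \<open>y\<^sup>k - z\<^sub>i\<^sup>k \<rightarrow> 0\<close>, which bounds the other sequences. Along a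
  subsequence with \<open>y\<^sup>k \<rightarrow> p\<close>, all \<open>z\<^sub>i\<^sup>k\<close> tend to \<open>p\<close> as well, and the proximal step for \<open>f\<^sub>m\<close> gives
  Frechet subgradients at \<open>y\<^sup>k\<close> that converge to \<open>-\<Sum>\<^sub>i \<nabla>f\<^sub>i(p)\<close>. Lower semicontinuity together with
  the minimality of \<open>y\<^sup>k\<close> gives \<open>f\<^sub>m(y\<^sup>k) \<rightarrow> f\<^sub>m(p)\<close>, so this limit is a limiting subgradient.
\<close>

section \<open>Quadratic bounds for smooth and hypoconvex functions\<close>

lemma descent_lemma:
  fixes f :: "'a::real_inner \<Rightarrow> real"
  assumes f: "\<And>u. GDERIV f u :> g u"
    and lip: "\<And>u v. norm (g u - g v) \<le> L * norm (u - v)"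
  shows "f b \<le> f a + inner (g a) (b - a) + L / 2 * (norm (b - a))\<^sup>2"
proof -
  define h where "h = (\<lambda>t. f (a + t *\<^sub>R (b - a)) - t * inner (g a) (b - a)
      - L / 2 * t\<^sup>2 * (norm (b - a))\<^sup>2)"
  define h' where "h' = (\<lambda>t. inner (g (a + t *\<^sub>R (b - a))) (b - a) - inner (g a) (b - a)
      - L * t * (norm (b - a))\<^sup>2)"
  have line: "((\<lambda>t. f (a + t *\<^sub>R (b - a))) has_real_derivative
      inner (g (a + t *\<^sub>R (b - a))) (b - a)) (at t)" for t
  proof -
    have "((\<lambda>t. a + t *\<^sub>R (b - a)) has_derivative (\<lambda>h. h *\<^sub>R (b - a))) (at t)"
      by (auto intro!: derivative_eq_intros)
    from has_derivative_compose[OF this f[of "a + t *\<^sub>R (b - a)", unfolded gderiv_def]]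
    show ?thesis
      by (simp add: has_field_derivative_def inner_commute mult_commute_abs)
  qed
  have der: "(h has_real_derivative h' t) (at t)" for t
    unfolding h_def h'_def by (rule line derivative_eq_intros refl)+ simp
  have "h' t \<le> 0" if "0 \<le> t" for t
  proof -
    have "inner (g (a + t *\<^sub>R (b - a)) - g a) (b - a)
        \<le> norm (g (a + t *\<^sub>R (b - a)) - g a) * norm (b - a)"
      by (rule norm_cauchy_schwarz)
    also have "\<dots> \<le> (L * norm (t *\<^sub>R (b - a))) * norm (b - a)"
      using lip[of "a + t *\<^sub>R (b - a)" a] by (intro mult_right_mono) auto
    also have "\<dots> = L * t * (norm (b - a))\<^sup>2"
      using that by (simp add: power2_eq_square)
    finally show ?thesis by (simp add: h'_def inner_diff_left)
  qed
  then have "h 1 \<le> h 0"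
    using der by (intro DERIV_nonpos_imp_nonincreasing[of 0 1 h]) (simp, blast)
  then show ?thesis by (simp add: h_def)
qed

lemma convex_above_tangent_plane:
  fixes h :: "'a::real_inner \<Rightarrow> real"
  assumes "convex_on UNIV h" and h: "GDERIV h a :> G"
  shows "h a + inner G (b - a) \<le> h b"
proof -
  have "((\<lambda>t. a + t *\<^sub>R (b - a)) has_derivative (\<lambda>h. h *\<^sub>R (b - a))) (at 0)"
    by (auto intro!: derivative_eq_intros)
  from has_derivative_compose[OF this, of h "\<lambda>v. inner v G"] h
  have der: "((\<lambda>t. h (a + t *\<^sub>R (b - a))) has_real_derivative inner G (b - a)) (at 0)"
    by (simp add: gderiv_def has_field_derivative_def inner_commute mult_commute_abs)
  have "convex_on UNIV (\<lambda>t. h (a + t *\<^sub>R (b - a)))"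
  proof (rule convex_onI)
    fix t r s :: real
    assume "0 < t" "t < 1"
    moreover have "a + ((1 - t) *\<^sub>R r + t *\<^sub>R s) *\<^sub>R (b - a)
        = (1 - t) *\<^sub>R (a + r *\<^sub>R (b - a)) + t *\<^sub>R (a + s *\<^sub>R (b - a))"
      by (simp add: algebra_simps)
    ultimately show "h (a + ((1 - t) *\<^sub>R r + t *\<^sub>R s) *\<^sub>R (b - a))
        \<le> (1 - t) * h (a + r *\<^sub>R (b - a)) + t * h (a + s *\<^sub>R (b - a))"
      using convex_onD[OF assms(1), of t] by simp
  qed auto
  from convex_on_imp_above_tangent[OF this, of 0 1 "inner G (b - a)"] der
  show ?thesis by simp
qed

text \<open>The function \<open>w \<mapsto> h w - h b - \<langle>g b, w - b\<rangle>\<close> is nonnegative, and one gradient step of length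
  \<open>1 / M\<close> from \<open>a\<close> lowers it by at least the squared gradient over \<open>2M\<close>.\<close>

lemma convex_bregman_lower_bound:
  fixes h :: "'a::real_inner \<Rightarrow> real"
  assumes conv: "convex_on UNIV h" and h: "\<And>u. GDERIV h u :> g u" and "0 < M"
    and upper: "\<And>a b. h b \<le> h a + inner (g a) (b - a) + M / 2 * (norm (b - a))\<^sup>2"
  shows "h b + inner (g b) (a - b) + (norm (g a - g b))\<^sup>2 / (2 * M) \<le> h a"
proof -
  define w where "w = a - (1 / M) *\<^sub>R (g a - g b)"
  have "h b + inner (g b) (w - b) \<le> h w"
    by (rule convex_above_tangent_plane[OF conv h])
  also have "\<dots> \<le> h a + inner (g a) (w - a) + M / 2 * (norm (w - a))\<^sup>2"
    by (rule upper)
  finally have "h b + inner (g b) (a - b) + inner (g b) (w - a)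
      \<le> h a + inner (g a) (w - a) + M / 2 * (norm (w - a))\<^sup>2"
    by (simp add: inner_diff_right)
  moreover have "inner (g a) (w - a) - inner (g b) (w - a) = - (norm (g a - g b))\<^sup>2 / M"
  proof -
    have "inner (g a) (w - a) - inner (g b) (w - a) = inner (g a - g b) (w - a)"
      by (simp only: inner_diff_left)
    then show ?thesis by (simp add: w_def power2_norm_eq_inner)
  qed
  moreover have "M / 2 * (norm (w - a))\<^sup>2 = (norm (g a - g b))\<^sup>2 / (2 * M)"
  proof -
    have "w - a = - ((1 / M) *\<^sub>R (g a - g b))" by (simp add: w_def)
    then have "norm (w - a) = norm (g a - g b) / M"
      using \<open>0 < M\<close> by (simp only: norm_minus_cancel norm_scaleR) simp
    then show ?thesis using \<open>0 < M\<close> by (simp add: power2_eq_square)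
  qed
  moreover have "(norm (g a - g b))\<^sup>2 / M = 2 * ((norm (g a - g b))\<^sup>2 / (2 * M))" by simp
  ultimately show ?thesis by linarith
qed

text \<open>The convex case applied to \<open>f - \<sigma>/2 \<parallel>\<cdot>\<parallel>\<^sup>2\<close>, which admits the quadratic upper bound with constant
  \<open>L - \<sigma>\<close>.\<close>

lemma hypoconvex_bregman_lower_bound:
  fixes f :: "'a::real_inner \<Rightarrow> real"
  assumes f: "\<And>u. GDERIV f u :> g u"
    and lip: "\<And>u v. norm (g u - g v) \<le> L * norm (u - v)"
    and conv: "convex_on UNIV (\<lambda>u. f u - \<sigma> / 2 * (norm u)\<^sup>2)"
    and "\<sigma> < L"
  shows "f b + inner (g b) (a - b) + \<sigma> / 2 * (norm (a - b))\<^sup>2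
      + (norm ((g a - g b) - \<sigma> *\<^sub>R (a - b)))\<^sup>2 / (2 * (L - \<sigma>)) \<le> f a"
proof -
  have quad: "\<sigma> / 2 * (norm v)\<^sup>2
      = \<sigma> / 2 * (norm u)\<^sup>2 + \<sigma> * inner u (v - u) + \<sigma> / 2 * (norm (v - u))\<^sup>2" for u v :: 'a
    by (simp add: power2_norm_eq_inner inner_diff_left inner_diff_right inner_commute algebra_simps)
  have "GDERIV (\<lambda>u. f u - \<sigma> / 2 * (norm u)\<^sup>2) u :> g u - \<sigma> *\<^sub>R u" for u
  proof -
    have "((\<lambda>u. inner u u) has_derivative (\<lambda>h. 2 * inner h u)) (at u)"
      by (auto intro!: derivative_eq_intros simp: inner_commute)
    then show ?thesis
      using f[of u] unfolding gderiv_def power2_norm_eq_inner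
      by (auto intro!: derivative_eq_intros simp: inner_diff_right inner_commute)
  qed
  moreover have "f v - \<sigma> / 2 * (norm v)\<^sup>2 \<le> f u - \<sigma> / 2 * (norm u)\<^sup>2
      + inner (g u - \<sigma> *\<^sub>R u) (v - u) + (L - \<sigma>) / 2 * (norm (v - u))\<^sup>2" for u v
    using descent_lemma[OF f lip, of v u] quad[of v u]
    by (simp add: inner_diff_left diff_divide_distrib add_divide_distrib left_diff_distrib)
  ultimately have "f b - \<sigma> / 2 * (norm b)\<^sup>2 + inner (g b - \<sigma> *\<^sub>R b) (a - b)
      + (norm ((g a - \<sigma> *\<^sub>R a) - (g b - \<sigma> *\<^sub>R b)))\<^sup>2 / (2 * (L - \<sigma>))
      \<le> f a - \<sigma> / 2 * (norm a)\<^sup>2"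
    using \<open>\<sigma> < L\<close> by (intro convex_bregman_lower_bound[OF conv]) auto
  moreover have "(g a - \<sigma> *\<^sub>R a) - (g b - \<sigma> *\<^sub>R b) = (g a - g b) - \<sigma> *\<^sub>R (a - b)"
    by (simp add: algebra_simps)
  ultimately show ?thesis
    using quad[of a b] by (simp add: inner_diff_left add_divide_distrib)
qed

section \<open>Decrease of the proximal-linear model\<close>

text \<open>Here \<open>d\<close> is a displacement, \<open>P + s d\<close> the corresponding difference of the scaled gradients \<open>\<gamma>g\<close>,
  and \<open>s = \<gamma>\<sigma>\<close>, \<open>l = \<gamma>L\<close> bound the scaled curvature. In one dimension \<open>P + s d = \<tau> d\<close> with
  \<open>s \<le> \<tau> \<le> l\<close>, the right-hand side is a quadratic polynomial in \<open>\<tau>\<close>, and the two terms of the minimum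
  are its values at the ends \<open>\<tau> = s\<close> and \<open>\<tau> = l\<close>. No smaller value occurs in between: when the
  polynomial is convex, its slope at \<open>\<tau> = s\<close> is \<open>-4s \<ge> 0\<close>. In higher dimensions cocoercivity replaces
  \<open>s \<le> \<tau> \<le> l\<close>.\<close>

lemma curvature_quadratic_form_bound:
  fixes d P :: "'a::real_inner"
  assumes s: "s \<le> 0" "s < l"
    and cocoercive: "(norm P)\<^sup>2 \<le> (l - s) * inner P d"
  shows "min ((1 - s) * (2 - \<mu> + 2 * s)) ((1 - l) * (2 - \<mu> + 2 * l)) * (norm d)\<^sup>2
    \<le> (\<mu> * s + 2 - \<mu>) * (norm d)\<^sup>2 + \<mu> / (l - s) * (norm P)\<^sup>2 - 2 * (norm (P + s *\<^sub>R d))\<^sup>2"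
proof -
  define w where "w = l - s"
  have w: "0 < w" using s by (simp add: w_def)
  define A where "A = (1 - s) * (2 - \<mu> + 2 * s)"
  define K where "K = \<mu> / w - 2 - 4 * s / w"
  have "(norm P)\<^sup>2 / w \<le> inner P d"
    using cocoercive w by (simp add: w_def field_simps)
  then have "- 4 * s * ((norm P)\<^sup>2 / w) \<le> - 4 * s * inner P d"
    using s by (intro mult_left_mono) auto
  moreover have "(norm (P + s *\<^sub>R d))\<^sup>2 = (norm P)\<^sup>2 + 2 * s * inner P d + s\<^sup>2 * (norm d)\<^sup>2"
    by (simp only: power2_norm_eq_inner)
      (simp add: inner_add_left inner_add_right inner_commute power2_eq_square algebra_simps)
  ultimately have lower: "A * (norm d)\<^sup>2 + K * (norm P)\<^sup>2
      \<le> (\<mu> * s + 2 - \<mu>) * (norm d)\<^sup>2 + \<mu> / w * (norm P)\<^sup>2 - 2 * (norm (P + s *\<^sub>R d))\<^sup>2"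
    by (simp add: A_def K_def algebra_simps power2_eq_square)
  (* The remaining form is affine in the squared norm of P, which ranges over
     [0, w^2 |d|^2]; the sign of K decides which end is the smaller one. *)
  have "norm P \<le> w * norm d"
  proof (cases "P = 0")
    case False
    have "norm P * norm P \<le> (w * norm d) * norm P"
      using cocoercive mult_left_mono[OF norm_cauchy_schwarz[of P d], of w] w
      by (simp add: w_def power2_eq_square algebra_simps)
    then show ?thesis using False by simp
  qed (use w in auto)
  then have P: "(norm P)\<^sup>2 \<le> w\<^sup>2 * (norm d)\<^sup>2"
    using power_mono[of "norm P" "w * norm d" 2] by (simp add: power_mult_distrib)
  have "min A ((1 - l) * (2 - \<mu> + 2 * l)) * (norm d)\<^sup>2 \<le> A * (norm d)\<^sup>2 + K * (norm P)\<^sup>2"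
  proof (cases "0 \<le> K")
    case True
    have "min A ((1 - l) * (2 - \<mu> + 2 * l)) * (norm d)\<^sup>2 \<le> A * (norm d)\<^sup>2"
      by (intro mult_right_mono) auto
    also have "\<dots> \<le> A * (norm d)\<^sup>2 + K * (norm P)\<^sup>2" using True by simp
    finally show ?thesis .
  next
    case False
    have "A + K * w\<^sup>2 = (1 - l) * (2 - \<mu> + 2 * l)"
    proof -
      have "K * w\<^sup>2 = \<mu> * w - 2 * w\<^sup>2 - 4 * s * w"
        using w by (simp add: K_def power2_eq_square field_simps)
      then show ?thesis by (simp add: A_def w_def power2_eq_square algebra_simps)
    qed
    then have "min A ((1 - l) * (2 - \<mu> + 2 * l)) * (norm d)\<^sup>2 \<le> (A + K * w\<^sup>2) * (norm d)\<^sup>2"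
      by (intro mult_right_mono) auto
    also have "\<dots> = A * (norm d)\<^sup>2 + K * (w\<^sup>2 * (norm d)\<^sup>2)" by (simp add: algebra_simps)
    also have "\<dots> \<le> A * (norm d)\<^sup>2 + K * (norm P)\<^sup>2"
      using mult_left_mono_neg[OF P, of K] False by simp
    finally show ?thesis .
  qed
  then show ?thesis using lower by (simp add: A_def w_def)
qed

definition prox_linear_model :: "('a::real_inner \<Rightarrow> real) \<Rightarrow> ('a \<Rightarrow> 'a) \<Rightarrow> real \<Rightarrow> 'a \<Rightarrow> 'a \<Rightarrow> real" where
  "prox_linear_model f g \<gamma> z w = f z + inner (g z) (w - z) + 1 / (2 * \<gamma>) * (norm (w - z))\<^sup>2"

text \<open>With \<open>\<gamma> L \<le> 1\<close> the quadratic term of the model dominates that of the descent lemma. For the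
  iteration this says that the envelope bounds the objective at \<open>y\<^sup>k\<close> from above, which is how
  coercivity enters.\<close>

lemma prox_linear_model_majorizes:
  fixes f :: "'a::real_inner \<Rightarrow> real"
  assumes "\<And>u. GDERIV f u :> g u" "\<And>u v. norm (g u - g v) \<le> L * norm (u - v)"
    and "0 < \<gamma>" "\<gamma> * L \<le> 1"
  shows "f w \<le> prox_linear_model f g \<gamma> z w"
proof -
  have "L / 2 \<le> 1 / (2 * \<gamma>)" using assms by (simp add: field_simps)
  then have "L / 2 * (norm (w - z))\<^sup>2 \<le> 1 / (2 * \<gamma>) * (norm (w - z))\<^sup>2"
    by (intro mult_right_mono) auto
  then show ?thesis
    using descent_lemma[OF assms(1,2), of w z] by (simp add: prox_linear_model_def)
qed

text \<open>With \<open>x = z + \<gamma> g z\<close>, the assumption is the update of \<open>x\<close>. It expresses \<open>y - z\<close> through the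
  displacement of \<open>z\<close> and the difference of the gradients, so that only these and a Bregman distance
  remain.\<close>

lemma prox_linear_model_diff:
  fixes f :: "'a::real_inner \<Rightarrow> real"
  assumes "0 < \<gamma>" "0 < \<mu>"
    and update: "zn + \<gamma> *\<^sub>R g zn = z + \<gamma> *\<^sub>R g z + \<mu> *\<^sub>R (y - z)"
  shows "2 * \<gamma> * \<mu> * (prox_linear_model f g \<gamma> z y - prox_linear_model f g \<gamma> zn y)
    = 2 * \<gamma> * \<mu> * (f z - f zn - inner (g zn) (z - zn))
      + (2 - \<mu>) * (norm (z - zn))\<^sup>2 - 2 * (norm (\<gamma> *\<^sub>R (g z - g zn)))\<^sup>2"
proof -
  define d e p where "d = z - zn" and "e = g z - g zn" and "p = y - z"
  have p: "\<mu> *\<^sub>R p = - (d + \<gamma> *\<^sub>R e)"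
    using update unfolding d_def e_def p_def by (simp add: algebra_simps)
  have "2 * \<gamma> * prox_linear_model f g \<gamma> z y = 2 * \<gamma> * (f z + inner (g z) p) + (norm p)\<^sup>2"
    "2 * \<gamma> * prox_linear_model f g \<gamma> zn y = 2 * \<gamma> * (f zn + inner (g zn) (p + d)) + (norm (p + d))\<^sup>2"
    using \<open>0 < \<gamma>\<close> by (simp_all add: prox_linear_model_def p_def d_def field_simps)
  then have diff: "2 * \<gamma> * (prox_linear_model f g \<gamma> z y - prox_linear_model f g \<gamma> zn y)
      = 2 * \<gamma> * (f z - f zn - inner (g zn) d) + 2 * \<gamma> * inner e p - 2 * inner p d - (norm d)\<^sup>2"
    by (simp add: e_def power2_norm_eq_inner inner_add_left inner_add_right inner_diff_left
        inner_commute algebra_simps)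
  have "\<mu> * (2 * \<gamma> * (prox_linear_model f g \<gamma> z y - prox_linear_model f g \<gamma> zn y))
      = \<mu> * (2 * \<gamma> * (f z - f zn - inner (g zn) d))
        + 2 * inner (\<gamma> *\<^sub>R e - d) (\<mu> *\<^sub>R p) - \<mu> * (norm d)\<^sup>2"
    unfolding diff by (simp add: inner_diff_left inner_commute algebra_simps)
  also have "inner (\<gamma> *\<^sub>R e - d) (\<mu> *\<^sub>R p) = (norm d)\<^sup>2 - (norm (\<gamma> *\<^sub>R e))\<^sup>2"
  proof -
    have "inner (E - d) (- (d + E)) = (norm d)\<^sup>2 - (norm E)\<^sup>2" for E
      by (simp add: power2_norm_eq_inner inner_diff_left inner_diff_right inner_commute)
    then show ?thesis unfolding p .
  qed
  finally show ?thesis by (simp add: d_def e_def algebra_simps)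
qed

text \<open>The constant must not depend on the points, since it is used along the whole iteration. The
  decrease is measured by \<open>y - z\<close>, which is at most a multiple of the displacement of \<open>z\<close>.\<close>

lemma prox_linear_model_decrease:
  fixes f :: "'a::real_inner \<Rightarrow> real"
  assumes f: "\<And>u. GDERIV f u :> g u"
    and lip: "\<And>u v. norm (g u - g v) \<le> L * norm (u - v)"
    and conv: "convex_on UNIV (\<lambda>u. f u - \<sigma> / 2 * (norm u)\<^sup>2)"
    and "0 < L" "\<sigma> \<le> 0" and mu: "0 < \<mu>" "\<mu> < 2"
    and step: "0 < \<gamma>" "\<gamma> * L < 1" "- (\<gamma> * \<sigma>) < 1 - \<mu> / 2"
  shows "\<exists>c>0. \<forall>z zn y. zn + \<gamma> *\<^sub>R g zn = z + \<gamma> *\<^sub>R g z + \<mu> *\<^sub>R (y - z) \<longrightarrow>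
    prox_linear_model f g \<gamma> zn y + c * (norm (y - z))\<^sup>2 \<le> prox_linear_model f g \<gamma> z y"
proof -
  define s l where "s = \<gamma> * \<sigma>" and "l = \<gamma> * L"
  have "0 < l" and s: "s \<le> 0" "s < l" "l < 1" "- s < 1 - \<mu> / 2"
    using assms by (auto simp: s_def l_def mult_le_0_iff)
  define C where "C = min ((1 - s) * (2 - \<mu> + 2 * s)) ((1 - l) * (2 - \<mu> + 2 * l))"
  have "0 < C" using s \<open>0 < l\<close> mu by (auto simp: C_def)
  define c where "c = C * (\<mu> / (1 + l))\<^sup>2 / (2 * \<gamma> * \<mu>)"
  have "0 < c" using \<open>0 < C\<close> \<open>0 < l\<close> mu step by (simp add: c_def)
  moreover have "prox_linear_model f g \<gamma> zn y + c * (norm (y - z))\<^sup>2 \<le> prox_linear_model f g \<gamma> z y"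
    if update: "zn + \<gamma> *\<^sub>R g zn = z + \<gamma> *\<^sub>R g z + \<mu> *\<^sub>R (y - z)" for z zn y
  proof -
    have "\<sigma> < L" using \<open>0 < L\<close> \<open>\<sigma> \<le> 0\<close> by linarith
    define d e Q where "d = z - zn" and "e = g z - g zn" and "Q = e - \<sigma> *\<^sub>R d"
    define P where "P = \<gamma> *\<^sub>R Q"
    have lower: "\<sigma> / 2 * (norm d)\<^sup>2 + (norm Q)\<^sup>2 / (2 * (L - \<sigma>)) \<le> f z - f zn - inner (g zn) d"
      using hypoconvex_bregman_lower_bound[OF f lip conv \<open>\<sigma> < L\<close>, of zn z]
      by (simp add: d_def e_def Q_def)
    have "g zn - g z - \<sigma> *\<^sub>R (zn - z) = - Q"
      by (simp add: d_def e_def Q_def algebra_simps)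
    then have lower': "\<sigma> / 2 * (norm d)\<^sup>2 + (norm Q)\<^sup>2 / (2 * (L - \<sigma>)) \<le> f zn - f z + inner (g z) d"
      using hypoconvex_bregman_lower_bound[OF f lip conv \<open>\<sigma> < L\<close>, of z zn]
      by (simp add: d_def norm_minus_commute inner_diff_right)
    have Q: "(norm Q)\<^sup>2 \<le> (L - \<sigma>) * inner Q d"
    proof -
      have "\<sigma> * (norm d)\<^sup>2 + (norm Q)\<^sup>2 / (L - \<sigma>) \<le> inner e d"
      proof -
        have "(norm Q)\<^sup>2 / (L - \<sigma>) = 2 * ((norm Q)\<^sup>2 / (2 * (L - \<sigma>)))"
          using \<open>\<sigma> < L\<close> by (simp add: field_simps)
        then show ?thesis
          using lower lower' by (simp add: e_def inner_diff_left)
      qed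
      then show ?thesis
        using \<open>\<sigma> < L\<close> by (simp add: Q_def inner_diff_left power2_norm_eq_inner field_simps)
    qed
    have "(norm P)\<^sup>2 \<le> (l - s) * inner P d"
    proof -
      have "\<gamma>\<^sup>2 * (norm Q)\<^sup>2 \<le> \<gamma>\<^sup>2 * ((L - \<sigma>) * inner Q d)"
        using Q by (intro mult_left_mono) auto
      then show ?thesis
        by (simp add: P_def l_def s_def power2_eq_square algebra_simps)
    qed
    from curvature_quadratic_form_bound[OF s(1,2) this, of \<mu>]
    have "C * (norm d)\<^sup>2 \<le> (\<mu> * s + 2 - \<mu>) * (norm d)\<^sup>2 + \<mu> / (l - s) * (norm P)\<^sup>2
        - 2 * (norm (P + s *\<^sub>R d))\<^sup>2"
      by (simp add: C_def)
    also have "\<mu> / (l - s) * (norm P)\<^sup>2 = \<gamma> * \<mu> * ((norm Q)\<^sup>2 / (L - \<sigma>))"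
      using \<open>\<sigma> < L\<close> \<open>0 < \<gamma>\<close> by (simp add: P_def l_def s_def power2_eq_square field_simps)
    also have "P + s *\<^sub>R d = \<gamma> *\<^sub>R e"
      by (simp add: P_def Q_def s_def algebra_simps)
    also have "(\<mu> * s + 2 - \<mu>) * (norm d)\<^sup>2 + \<gamma> * \<mu> * ((norm Q)\<^sup>2 / (L - \<sigma>)) - 2 * (norm (\<gamma> *\<^sub>R e))\<^sup>2
        = 2 * \<gamma> * \<mu> * (\<sigma> / 2 * (norm d)\<^sup>2 + (norm Q)\<^sup>2 / (2 * (L - \<sigma>)))
          + (2 - \<mu>) * (norm d)\<^sup>2 - 2 * (norm (\<gamma> *\<^sub>R e))\<^sup>2"
      using \<open>\<sigma> < L\<close> by (simp add: s_def field_simps)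
    also have "\<dots> \<le> 2 * \<gamma> * \<mu> * (f z - f zn - inner (g zn) d)
          + (2 - \<mu>) * (norm d)\<^sup>2 - 2 * (norm (\<gamma> *\<^sub>R e))\<^sup>2"
      using lower step mu by simp
    also have "\<dots> = 2 * \<gamma> * \<mu> * (prox_linear_model f g \<gamma> z y - prox_linear_model f g \<gamma> zn y)"
      using prox_linear_model_diff[OF \<open>0 < \<gamma>\<close> \<open>0 < \<mu>\<close> update] by (simp add: d_def e_def)
    finally have main: "C * (norm d)\<^sup>2
        \<le> 2 * \<gamma> * \<mu> * (prox_linear_model f g \<gamma> z y - prox_linear_model f g \<gamma> zn y)" .
    (* It remains to replace the displacement d by y - z, using that g is Lipschitz. *)
    have "\<mu> *\<^sub>R (y - z) = - (d + \<gamma> *\<^sub>R e)"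
      using update unfolding d_def e_def by (simp add: algebra_simps)
    then have "\<mu> * norm (y - z) = norm (d + \<gamma> *\<^sub>R e)"
      using mu by (metis abs_of_pos norm_minus_cancel norm_scaleR)
    also have "\<dots> \<le> norm d + \<gamma> * norm e"
      using norm_triangle_ineq[of d "\<gamma> *\<^sub>R e"] \<open>0 < \<gamma>\<close> by simp
    also have "\<dots> \<le> (1 + l) * norm d"
      using lip[of z zn] \<open>0 < \<gamma>\<close> by (simp add: d_def e_def l_def algebra_simps mult_left_mono)
    finally have "\<mu> / (1 + l) * norm (y - z) \<le> norm d"
      using \<open>0 < l\<close> by (simp add: field_simps)
    then have "(\<mu> / (1 + l))\<^sup>2 * (norm (y - z))\<^sup>2 \<le> (norm d)\<^sup>2"
      using power_mono[of "\<mu> / (1 + l) * norm (y - z)" "norm d" 2] \<open>0 < l\<close> mu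
      by (simp only: power_mult_distrib) simp
    then have "C * ((\<mu> / (1 + l))\<^sup>2 * (norm (y - z))\<^sup>2) \<le> C * (norm d)\<^sup>2"
      using \<open>0 < C\<close> by (intro mult_left_mono) auto
    also note main
    also have "C * ((\<mu> / (1 + l))\<^sup>2 * (norm (y - z))\<^sup>2) = 2 * \<gamma> * \<mu> * (c * (norm (y - z))\<^sup>2)"
      using step mu by (simp add: c_def)
    finally show ?thesis using step mu by simp
  qed
  ultimately show ?thesis by blast
qed

text \<open>The case distinction in the bound on the step size selects the more restrictive of the two
  inequalities, so that both hold in either case.\<close>

lemma step_size_bounds:
  assumes "0 < L" "\<sigma> \<in> {- L..0}" "0 < \<mu>" "\<mu> < 2" "\<gamma> \<in> {0<..<gamma_bar \<mu> L \<sigma>}"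
  shows "\<gamma> * L < 1" "- (\<gamma> * \<sigma>) < 1 - \<mu> / 2"
proof -
  have \<gamma>: "0 < \<gamma>" "\<gamma> < gamma_bar \<mu> L \<sigma>" using assms by auto
  have "\<gamma> * L < 1 \<and> - (\<gamma> * \<sigma>) < 1 - \<mu> / 2"
  proof (cases "- 2 * \<sigma> < (2 - \<mu>) * L")
    case True
    then have l: "\<gamma> * L < 1" using \<gamma> assms(1) by (simp add: gamma_bar_def field_simps)
    have "\<gamma> * (- 2 * \<sigma>) < \<gamma> * ((2 - \<mu>) * L)" using True \<gamma> by (intro mult_strict_left_mono) auto
    also have "\<dots> = (2 - \<mu>) * (\<gamma> * L)" by simp
    also have "\<dots> \<le> (2 - \<mu>) * 1" using l assms by (intro mult_left_mono) auto
    finally show ?thesis using l by simp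
  next
    case False
    have "0 < (2 - \<mu>) * L" using assms by simp
    then have "\<sigma> < 0" using False by linarith
    then have s: "\<gamma> * (- 2 * \<sigma>) < 2 - \<mu>"
      using \<gamma> False by (simp add: gamma_bar_def field_simps)
    have "(2 - \<mu>) * (\<gamma> * L) = \<gamma> * ((2 - \<mu>) * L)" by simp
    also have "\<dots> \<le> \<gamma> * (- 2 * \<sigma>)" using False \<gamma> by (intro mult_left_mono) auto
    also note s
    finally have "\<gamma> * L < 1" using assms by simp
    then show ?thesis using s by simp
  qed
  then show "\<gamma> * L < 1" "- (\<gamma> * \<sigma>) < 1 - \<mu> / 2" by auto
qed

section \<open>Subgradients and proximal points\<close>

text \<open>A quadratic minorant makes \<open>v\<close> a proximal subgradient: the difference quotient is bounded below
  by \<open>-a \<parallel>u - w\<parallel>\<close>, which vanishes in the limit. Both sources of subgradients in the proof, smooth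
  functions and proximal points, provide such a minorant.\<close>

lemma quadratic_minorant_imp_frechet_subdiff:
  fixes F :: "'a::euclidean_space \<Rightarrow> ereal"
  assumes "\<bar>F w\<bar> \<noteq> \<infinity>"
    and minorant: "\<And>u. F w + ereal (inner v (u - w) - a * (norm (u - w))\<^sup>2) \<le> F u"
  shows "v \<in> frechet_subdiff F w"
proof -
  obtain b where b: "F w = ereal b" using assms(1) by auto
  have "((\<lambda>u. - a * norm (u - w)) \<longlongrightarrow> - a * norm (w - w)) (at w)"
    by (intro tendsto_intros)
  then have "((\<lambda>u. ereal (- a * norm (u - w))) \<longlongrightarrow> 0) (at w)"
    by (simp add: zero_ereal_def)
  then have "Liminf (at w) (\<lambda>u. ereal (- a * norm (u - w))) = 0"
    by (intro lim_imp_Liminf) auto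
  moreover have "Liminf (at w) (\<lambda>u. ereal (- a * norm (u - w)))
      \<le> Liminf (at w) (\<lambda>u. (F u - F w - ereal (inner v (u - w))) / ereal (norm (u - w)))"
  proof (rule Liminf_mono, rule eventually_at_ball'[THEN eventually_mono, of 1 w UNIV])
    fix u assume u: "u \<in> ball w 1 \<and> u \<noteq> w \<and> u \<in> UNIV"
    then have pos: "0 < norm (u - w)" by simp
    show "ereal (- a * norm (u - w)) \<le> (F u - F w - ereal (inner v (u - w))) / ereal (norm (u - w))"
    proof (cases "F u")
      case (real c)
      have "- a * norm (u - w) * norm (u - w) \<le> c - b - inner v (u - w)"
        using minorant[of u] real b by (simp add: power2_eq_square)
      then show ?thesis using pos real b by (simp add: pos_le_divide_eq)
    next
      case PInf
      then show ?thesis using pos b by simp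
    next
      case MInf
      then show ?thesis using minorant[of u] b by simp
    qed
  qed simp
  ultimately show ?thesis using b by (simp add: frechet_subdiff_def dom_ext_def)
qed

text \<open>The descent lemma for \<open>-f\<close> is a quadratic minorant of \<open>f\<close>; constant sequences then suffice.\<close>

lemma gradient_in_limiting_subdiff:
  fixes f :: "'a::euclidean_space \<Rightarrow> real"
  assumes f: "\<And>u. GDERIV f u :> g u"
    and lip: "\<And>u v. norm (g u - g v) \<le> L * norm (u - v)"
  shows "g p \<in> limiting_subdiff (\<lambda>u. ereal (f u)) p"
proof -
  have "g p \<in> frechet_subdiff (\<lambda>u. ereal (f u)) p"
  proof (rule quadratic_minorant_imp_frechet_subdiff)
    fix u
    have "GDERIV (\<lambda>u. - f u) w :> - g w" for w using f by (rule GDERIV_minus)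
    moreover have "norm (- g v - - g w) \<le> L * norm (v - w)" for v w
      using lip[of v w] by (simp add: norm_minus_commute)
    ultimately have "- f u \<le> - f p + inner (- g p) (u - p) + L / 2 * (norm (u - p))\<^sup>2"
      by (rule descent_lemma)
    then show "ereal (f p) + ereal (inner (g p) (u - p) - L / 2 * (norm (u - p))\<^sup>2) \<le> ereal (f u)"
      by simp
  qed simp
  then show ?thesis
    unfolding limiting_subdiff_def dom_ext_def
    by (simp, intro exI[of _ "\<lambda>_. p"], simp, intro exI[of _ "\<lambda>_. g p"], simp)
qed

lemma prox_le:
  assumes "w \<in> prox \<gamma> F v"
  shows "F w + ereal (1 / (2 * \<gamma>) * (norm (w - v))\<^sup>2) \<le> F u + ereal (1 / (2 * \<gamma>) * (norm (u - v))\<^sup>2)"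
  using assms by (auto simp: prox_def is_arg_min_def not_less)

lemma prox_in_dom:
  assumes "w \<in> prox \<gamma> F v" "proper_fun F"
  shows "\<bar>F w\<bar> \<noteq> \<infinity>"
proof -
  obtain u where "F u < \<infinity>" using assms(2) by (auto simp: proper_fun_def dom_ext_def)
  then have "F w \<noteq> \<infinity>"
    using prox_le[OF assms(1), of u] by (cases "F u") auto
  then show ?thesis using assms(2) by (auto simp: proper_fun_def)
qed

lemma prox_imp_frechet_subdiff:
  fixes F :: "'a::euclidean_space \<Rightarrow> ereal"
  assumes "w \<in> prox \<gamma> F v" "\<bar>F w\<bar> \<noteq> \<infinity>"
  shows "(1 / \<gamma>) *\<^sub>R (v - w) \<in> frechet_subdiff F w"
proof (rule quadratic_minorant_imp_frechet_subdiff[where a = "1 / (2 * \<gamma>)"])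
  show "\<bar>F w\<bar> \<noteq> \<infinity>" by (fact assms(2))
next
  fix u
  have "(norm (u - v))\<^sup>2 = (norm (w - v))\<^sup>2 - 2 * inner (v - w) (u - w) + (norm (u - w))\<^sup>2"
    by (simp add: power2_norm_eq_inner inner_diff_left inner_diff_right inner_commute)
  then have "inner ((1 / \<gamma>) *\<^sub>R (v - w)) (u - w) - 1 / (2 * \<gamma>) * (norm (u - w))\<^sup>2
      = 1 / (2 * \<gamma>) * (norm (w - v))\<^sup>2 - 1 / (2 * \<gamma>) * (norm (u - v))\<^sup>2"
    by (simp add: diff_divide_distrib add_divide_distrib)
  then show "F w + ereal (inner ((1 / \<gamma>) *\<^sub>R (v - w)) (u - w) - 1 / (2 * \<gamma>) * (norm (u - w))\<^sup>2) \<le> F u"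
    using prox_le[OF assms(1), of u] assms(2) by (cases "F w"; cases "F u") auto
qed

lemma prox_of_differentiable:
  fixes f :: "'a::real_inner \<Rightarrow> real"
  assumes z: "z \<in> prox \<gamma> (\<lambda>u. ereal (f u)) x" and f: "GDERIV f z :> G" and "\<gamma> \<noteq> 0"
  shows "x = z + \<gamma> *\<^sub>R G"
proof -
  define c where "c = 1 / (2 * \<gamma>)"
  let ?h = "\<lambda>w. f w + c * inner (w - x) (w - x)"
  have "(?h has_derivative (\<lambda>h. inner h G + c * (inner (z - x) h + inner h (z - x)))) (at z)"
    using f unfolding gderiv_def by (auto intro!: derivative_eq_intros)
  moreover have "?h z \<le> ?h w" for w
    using prox_le[OF z, of w] by (simp add: power2_norm_eq_inner c_def)
  ultimately have "(\<lambda>h. inner h G + c * (inner (z - x) h + inner h (z - x))) = (\<lambda>h. 0)"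
    by (intro has_derivative_local_min) auto
  then have "inner h G + c * (inner (z - x) h + inner h (z - x)) = 0" for h
    by (rule fun_cong)
  moreover have "inner h (\<gamma> *\<^sub>R G + (z - x))
      = \<gamma> * (inner h G + c * (inner (z - x) h + inner h (z - x)))" for h
    using \<open>\<gamma> \<noteq> 0\<close> by (simp add: c_def inner_add_right inner_commute[of "z - x"] distrib_left)
  ultimately have "inner h (\<gamma> *\<^sub>R G + (z - x)) = 0" for h
    by simp
  from this[of "\<gamma> *\<^sub>R G + (z - x)"] have "\<gamma> *\<^sub>R G + (z - x) = 0"
    by (simp only: inner_eq_zero_iff)
  then show ?thesis by (simp add: algebra_simps)
qed

text \<open>The lower limit in the definition of a closed function leaves out the point itself; the values
  at \<open>p\<close> are covered by \<open>c < F p\<close>, so sequences that hit \<open>p\<close> are allowed.\<close>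

lemma closed_fun_eventually_greater:
  assumes "closed_fun F" and s: "(s \<longlongrightarrow> p) \<F>" and "c < F p"
  shows "\<forall>\<^sub>F n in \<F>. c < F (s n)"
proof -
  have "c < Liminf (at p) F"
    using assms by (meson closed_fun_def less_le_trans)
  then have "\<forall>\<^sub>F u in at p. c < F u" by (rule less_LiminfD)
  then have "\<forall>\<^sub>F u in nhds p. c < F u"
    using \<open>c < F p\<close> by (auto simp: eventually_at_filter elim: eventually_mono)
  then show ?thesis using s by (rule eventually_compose_filterlim)
qed

text \<open>Up to a constant, a weighted sum of squared distances is the squared distance to the barycentre.
  This is why a single proximal step at an averaged point serves all the models at once.\<close>

lemma weighted_sum_of_squares:
  fixes p :: "'i \<Rightarrow> 'a::real_inner"
  assumes "(\<Sum>i\<in>I. a i) = 1"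
  shows "\<exists>C. \<forall>w. (\<Sum>i\<in>I. a i * (norm (w - p i))\<^sup>2) = (norm (w - (\<Sum>i\<in>I. a i *\<^sub>R p i)))\<^sup>2 + C"
proof (intro exI allI)
  fix w
  have "(\<Sum>i\<in>I. a i * (norm (w - p i))\<^sup>2)
      = (\<Sum>i\<in>I. a i * (norm w)\<^sup>2 - 2 * inner w (a i *\<^sub>R p i) + a i * (norm (p i))\<^sup>2)"
    by (intro sum.cong refl)
      (simp add: power2_norm_eq_inner inner_diff_left inner_diff_right inner_commute algebra_simps)
  also have "\<dots> = (\<Sum>i\<in>I. a i) * (norm w)\<^sup>2 - 2 * inner w (\<Sum>i\<in>I. a i *\<^sub>R p i)
      + (\<Sum>i\<in>I. a i * (norm (p i))\<^sup>2)"
    by (simp add: sum.distrib sum_subtractf sum_distrib_right sum_distrib_left inner_sum_right)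
  finally show "(\<Sum>i\<in>I. a i * (norm (w - p i))\<^sup>2) = (norm (w - (\<Sum>i\<in>I. a i *\<^sub>R p i)))\<^sup>2
      + ((\<Sum>i\<in>I. a i * (norm (p i))\<^sup>2) - (norm (\<Sum>i\<in>I. a i *\<^sub>R p i))\<^sup>2)"
    using assms by (simp add: power2_norm_eq_inner inner_diff_left inner_diff_right inner_commute)
qed

lemma sum_in_set_sum:
  fixes A :: "'i \<Rightarrow> 'a::comm_monoid_add set"
  assumes "finite I" "\<And>i. i \<in> I \<Longrightarrow> a i \<in> A i"
  shows "sum a I \<in> sum A I"
  using assms by (induction I) auto

section \<open>The iteration and its envelope\<close>

text \<open>The smooth functions are indexed by an arbitrary finite set, their gradients are named, and the
  bound on the step size is replaced by the two inequalities that it implies.\<close>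

locale parallel_douglas_rachford =
  fixes I :: "'i set"
    and f :: "'i \<Rightarrow> 'a::euclidean_space \<Rightarrow> real" and g :: "'i \<Rightarrow> 'a \<Rightarrow> 'a" and L \<sigma> :: "'i \<Rightarrow> real"
    and F :: "'a \<Rightarrow> ereal"
    and lam \<mu> :: real and lams :: "'i \<Rightarrow> real"
    and x z :: "'i \<Rightarrow> nat \<Rightarrow> 'a" and y :: "nat \<Rightarrow> 'a"
  assumes finite_index: "finite I"
    and gradient: "\<And>i u. i \<in> I \<Longrightarrow> GDERIV (f i) u :> g i u"
    and lipschitz: "\<And>i u v. i \<in> I \<Longrightarrow> norm (g i u - g i v) \<le> L i * norm (u - v)"
    and L_pos: "\<And>i. i \<in> I \<Longrightarrow> 0 < L i"
    and sigma_nonpos: "\<And>i. i \<in> I \<Longrightarrow> \<sigma> i \<le> 0"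
    and hypoconvex: "\<And>i. i \<in> I \<Longrightarrow> convex_on UNIV (\<lambda>u. f i u - \<sigma> i / 2 * (norm u)\<^sup>2)"
    and proper: "proper_fun F" and closed: "closed_fun F"
    and coercive: "coercive (\<lambda>u. ereal (\<Sum>i\<in>I. f i u) + F u)"
    and mu: "0 < \<mu>" "\<mu> < 2"
    and lam_pos: "0 < lam" and lams_pos: "\<And>i. i \<in> I \<Longrightarrow> 0 < lams i"
    and lams_sum: "(\<Sum>i\<in>I. lams i) = 1"
    and step_L: "\<And>i. i \<in> I \<Longrightarrow> lam / lams i * L i < 1"
    and step_sigma: "\<And>i. i \<in> I \<Longrightarrow> - (lam / lams i * \<sigma> i) < 1 - \<mu> / 2"
    and z_step: "\<And>i k. i \<in> I \<Longrightarrow> z i k \<in> prox (lam / lams i) (\<lambda>u. ereal (f i u)) (x i k)"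
    and y_step: "\<And>k. y k \<in> prox lam F (\<Sum>i\<in>I. lams i *\<^sub>R (2 *\<^sub>R z i k - x i k))"
    and x_step: "\<And>i k. i \<in> I \<Longrightarrow> x i (Suc k) = x i k + \<mu> *\<^sub>R (y k - z i k)"
begin

abbreviation \<gamma> :: "'i \<Rightarrow> real" where
  "\<gamma> i \<equiv> lam / lams i"

abbreviation center :: "nat \<Rightarrow> 'a" where
  "center k \<equiv> \<Sum>i\<in>I. lams i *\<^sub>R (2 *\<^sub>R z i k - x i k)"

definition model :: "nat \<Rightarrow> 'a \<Rightarrow> real" where
  "model k w = (\<Sum>i\<in>I. prox_linear_model (f i) (g i) (\<gamma> i) (z i k) w)"

text \<open>The values \<open>F (y k)\<close> are finite, and real numbers are more convenient for the Lyapunov argument.\<close>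

definition Fy :: "nat \<Rightarrow> real" where
  "Fy k = real_of_ereal (F (y k))"

definition envelope :: "nat \<Rightarrow> real" where
  "envelope k = Fy k + model k (y k)"

lemma gamma_pos: "i \<in> I \<Longrightarrow> 0 < \<gamma> i"
  using lam_pos lams_pos by simp

lemma F_y: "F (y k) = ereal (Fy k)"
  using prox_in_dom[OF y_step proper, of k] by (simp add: Fy_def ereal_real)

lemma x_eq:
  assumes "i \<in> I"
  shows "x i k = z i k + \<gamma> i *\<^sub>R g i (z i k)"
  by (rule prox_of_differentiable[OF z_step[OF assms] gradient[OF assms]])
    (use lam_pos lams_pos[OF assms] in simp)

text \<open>By \<open>x\<^sub>i = z\<^sub>i + \<gamma>\<^sub>i g\<^sub>i(z\<^sub>i)\<close>, completing the square in the \<open>i\<close>-th model gives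
  \<open>\<parallel>w - (2z\<^sub>i - x\<^sub>i)\<parallel>\<^sup>2 / (2\<gamma>\<^sub>i)\<close> plus a constant, and \<open>1 / \<gamma>\<^sub>i = \<lambda>\<^sub>i / \<lambda>\<close> turns the sum over \<open>i\<close> into a
  weighted sum of squares.\<close>

lemma model_eq_prox_objective:
  "\<exists>C. \<forall>w. model k w = 1 / (2 * lam) * (norm (w - center k))\<^sup>2 + C"
proof -
  obtain C where C: "\<And>w. (\<Sum>i\<in>I. lams i * (norm (w - (2 *\<^sub>R z i k - x i k)))\<^sup>2)
      = (norm (w - center k))\<^sup>2 + C"
    using weighted_sum_of_squares[OF lams_sum, of "\<lambda>i. 2 *\<^sub>R z i k - x i k"] by blast
  define D where "D = (\<Sum>i\<in>I. f i (z i k) - \<gamma> i / 2 * (norm (g i (z i k)))\<^sup>2)"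
  have "prox_linear_model (f i) (g i) (\<gamma> i) (z i k) w
      = f i (z i k) - \<gamma> i / 2 * (norm (g i (z i k)))\<^sup>2
        + 1 / (2 * lam) * (lams i * (norm (w - (2 *\<^sub>R z i k - x i k)))\<^sup>2)" if "i \<in> I" for i w
  proof -
    have "w - (2 *\<^sub>R z i k - x i k) = (w - z i k) + \<gamma> i *\<^sub>R g i (z i k)"
      using x_eq[OF that, of k] by (simp add: scaleR_2)
    then have "(norm (w - (2 *\<^sub>R z i k - x i k)))\<^sup>2
        = (norm (w - z i k))\<^sup>2 + 2 * \<gamma> i * inner (g i (z i k)) (w - z i k)
          + (\<gamma> i)\<^sup>2 * (norm (g i (z i k)))\<^sup>2"
      by (simp only: power2_norm_eq_inner)
        (simp add: inner_add_left inner_add_right inner_commute power2_eq_square algebra_simps)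
    moreover have "1 / (2 * lam) * (lams i * t) = 1 / (2 * \<gamma> i) * t" for t by simp
    moreover have "1 / (2 * c) * (n + 2 * c * p + c\<^sup>2 * q) = 1 / (2 * c) * n + p + c / 2 * q"
      if "c \<noteq> 0" for c n p q :: real
      using that by (simp add: power2_eq_square field_simps)
    ultimately show ?thesis
      using gamma_pos[OF that] by (simp only: prox_linear_model_def)
  qed
  then have "model k w = D + 1 / (2 * lam) * (\<Sum>i\<in>I. lams i * (norm (w - (2 *\<^sub>R z i k - x i k)))\<^sup>2)"
    for w
    by (simp add: model_def D_def sum.distrib sum_distrib_left)
  then have "model k w = D + 1 / (2 * lam) * ((norm (w - center k))\<^sup>2 + C)" for w
    by (simp only: C)
  then have "model k w = 1 / (2 * lam) * (norm (w - center k))\<^sup>2 + (D + 1 / (2 * lam) * C)" for w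
    by (simp add: algebra_simps)
  then show ?thesis by blast
qed

lemma y_minimizes_model: "F (y k) + ereal (model k (y k)) \<le> F w + ereal (model k w)"
proof -
  obtain C where C: "\<And>w. model k w = 1 / (2 * lam) * (norm (w - center k))\<^sup>2 + C"
    using model_eq_prox_objective by blast
  show ?thesis
    unfolding C using prox_le[OF y_step, of k w] F_y[of k] by (cases "F w") auto
qed

text \<open>The point \<open>y k\<close> is a competitor for the minimizer \<open>y (Suc k)\<close>, so the envelope falls at least as
  much as the models do at the fixed point \<open>y k\<close>.\<close>

lemma envelope_decrease:
  obtains c where "\<And>i. i \<in> I \<Longrightarrow> 0 < c i"
    and "\<And>k. envelope (Suc k) + (\<Sum>i\<in>I. c i * (norm (y k - z i k))\<^sup>2) \<le> envelope k"
proof -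
  let ?decr = "\<lambda>i c. \<forall>a an b. an + \<gamma> i *\<^sub>R g i an = a + \<gamma> i *\<^sub>R g i a + \<mu> *\<^sub>R (b - a) \<longrightarrow>
      prox_linear_model (f i) (g i) (\<gamma> i) an b + c * (norm (b - a))\<^sup>2
      \<le> prox_linear_model (f i) (g i) (\<gamma> i) a b"
  have "\<forall>i\<in>I. \<exists>c>0. ?decr i c"
  proof
    fix i assume i: "i \<in> I"
    show "\<exists>c>0. ?decr i c"
      by (rule prox_linear_model_decrease[OF gradient[OF i] lipschitz[OF i] hypoconvex[OF i]
            L_pos[OF i] sigma_nonpos[OF i] mu gamma_pos[OF i] step_L[OF i] step_sigma[OF i]])
  qed
  from bchoice[OF this] obtain c where c: "\<And>i. i \<in> I \<Longrightarrow> 0 < c i"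
    and decr: "\<And>i. i \<in> I \<Longrightarrow> ?decr i (c i)"
    by blast
  have "envelope (Suc k) + (\<Sum>i\<in>I. c i * (norm (y k - z i k))\<^sup>2) \<le> envelope k" for k
  proof -
    have "model (Suc k) (y k) + (\<Sum>i\<in>I. c i * (norm (y k - z i k))\<^sup>2) \<le> model k (y k)"
      unfolding model_def sum.distrib[symmetric]
    proof (intro sum_mono decr[rule_format])
      fix i assume "i \<in> I"
      then show "z i (Suc k) + \<gamma> i *\<^sub>R g i (z i (Suc k))
          = z i k + \<gamma> i *\<^sub>R g i (z i k) + \<mu> *\<^sub>R (y k - z i k)"
        using x_step[of i k] x_eq[of i] by simp
    qed
    moreover have "envelope (Suc k) \<le> Fy k + model (Suc k) (y k)"
      using y_minimizes_model[of "Suc k" "y k"] by (simp add: envelope_def F_y)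
    ultimately show ?thesis by (simp add: envelope_def)
  qed
  then show thesis using that c by blast
qed

lemma envelope_decseq: "decseq envelope"
proof -
  obtain c where c: "\<And>i. i \<in> I \<Longrightarrow> 0 < c i"
    and decr: "\<And>k. envelope (Suc k) + (\<Sum>i\<in>I. c i * (norm (y k - z i k))\<^sup>2) \<le> envelope k"
    by (fact envelope_decrease)
  have "0 \<le> (\<Sum>i\<in>I. c i * (norm (y k - z i k))\<^sup>2)" for k
    using c by (intro sum_nonneg) (simp add: less_imp_le)
  then show ?thesis
    using decr unfolding decseq_Suc_iff by (meson le_add_same_cancel1 order_trans)
qed

lemma smooth_part_le_model: "(\<Sum>i\<in>I. f i w) \<le> model k w"
  unfolding model_def
proof (rule sum_mono)
  fix i assume i: "i \<in> I"
  show "f i w \<le> prox_linear_model (f i) (g i) (\<gamma> i) (z i k) w"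
    by (rule prox_linear_model_majorizes[OF gradient[OF i] lipschitz[OF i] gamma_pos[OF i]
          less_imp_le[OF step_L[OF i]]])
qed

lemma objective_le_envelope: "(\<Sum>i\<in>I. f i (y k)) + Fy k \<le> envelope 0"
proof -
  have "(\<Sum>i\<in>I. f i (y k)) + Fy k \<le> envelope k"
    using smooth_part_le_model[of "y k" k] by (simp add: envelope_def)
  also have "\<dots> \<le> envelope 0"
    using envelope_decseq by (simp add: decseq_def)
  finally show ?thesis .
qed

section \<open>Boundedness of the iterates\<close>

lemma bounded_y: "bounded (range y)"
proof -
  have "\<forall>\<^sub>F u in at_infinity. ereal (envelope 0) < ereal (\<Sum>i\<in>I. f i u) + F u"
    using coercive unfolding coercive_def by (rule order_tendstoD(1)) simp
  then obtain b where b: "\<And>u. b \<le> norm u \<Longrightarrow> ereal (envelope 0) < ereal (\<Sum>i\<in>I. f i u) + F u"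
    by (auto simp: eventually_at_infinity)
  have "norm (y k) \<le> b" for k
  proof (rule ccontr)
    assume "\<not> norm (y k) \<le> b"
    then have "envelope 0 < (\<Sum>i\<in>I. f i (y k)) + Fy k"
      using b[of "y k"] by (simp add: F_y)
    then show False using objective_le_envelope[of k] by simp
  qed
  then show ?thesis by (auto simp: bounded_iff)
qed

lemma continuous_f: "i \<in> I \<Longrightarrow> continuous_on UNIV (f i)"
  using gradient by (auto simp: continuous_on_eq_continuous_at gderiv_def
      intro: has_derivative_continuous)

lemma continuous_g: "i \<in> I \<Longrightarrow> continuous_on UNIV (g i)"
  using lipschitz[of i] L_pos[of i]
  by (intro lipschitz_on_continuous_on[of "L i"] lipschitz_onI) (auto simp: dist_norm)

lemma smooth_part_bounded: "bounded (range (\<lambda>k. \<Sum>i\<in>I. f i (y k)))"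
proof -
  have "compact (closure (range y))" using bounded_y by simp
  moreover have "continuous_on (closure (range y)) (\<lambda>u. \<Sum>i\<in>I. f i u)"
    using continuous_f by (intro continuous_on_sum) (blast intro: continuous_on_subset)
  ultimately have "bounded ((\<lambda>u. \<Sum>i\<in>I. f i u) ` closure (range y))"
    by (intro compact_imp_bounded compact_continuous_image)
  then show ?thesis
    by (rule bounded_subset) (auto intro!: image_eqI closure_subset[THEN subsetD])
qed

text \<open>The minimality of \<open>y 0\<close> in its proximal problem bounds \<open>F\<close> from below by a concave quadratic
  function, which is bounded on the bounded sequence \<open>y\<close>.\<close>

lemma envelope_bounded_below: "\<exists>B. \<forall>k. B \<le> envelope k"
proof -
  obtain A where A: "\<And>k. \<bar>\<Sum>i\<in>I. f i (y k)\<bar> \<le> A"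
    using smooth_part_bounded by (auto simp: bounded_iff)
  obtain R where R: "\<And>k. norm (y k) \<le> R"
    using bounded_y by (auto simp: bounded_iff)
  have "- A + (Fy 0 - 1 / (2 * lam) * (R + norm (center 0))\<^sup>2) \<le> envelope k" for k
  proof -
    have "Fy 0 + 1 / (2 * lam) * (norm (y 0 - center 0))\<^sup>2
        \<le> Fy k + 1 / (2 * lam) * (norm (y k - center 0))\<^sup>2"
      using prox_le[OF y_step, of 0 "y k"] by (simp add: F_y)
    moreover have "0 \<le> 1 / (2 * lam) * (norm (y 0 - center 0))\<^sup>2" using lam_pos by simp
    moreover have "1 / (2 * lam) * (norm (y k - center 0))\<^sup>2
        \<le> 1 / (2 * lam) * (R + norm (center 0))\<^sup>2"
    proof (intro mult_left_mono power_mono)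
      show "norm (y k - center 0) \<le> R + norm (center 0)"
        using norm_triangle_ineq4[of "y k" "center 0"] R[of k] by linarith
    qed (use lam_pos in auto)
    ultimately show ?thesis
      using A[of k] smooth_part_le_model[of "y k" k] by (simp only: envelope_def)
  qed
  then show ?thesis by blast
qed

text \<open>The envelope decreases to a limit, so its successive differences, which dominate the squared
  residuals, tend to zero.\<close>

lemma residual_tendsto_zero:
  assumes "i \<in> I"
  shows "(\<lambda>k. y k - z i k) \<longlonglongrightarrow> 0"
proof -
  obtain c where c: "\<And>i. i \<in> I \<Longrightarrow> 0 < c i"
    and decr: "\<And>k. envelope (Suc k) + (\<Sum>i\<in>I. c i * (norm (y k - z i k))\<^sup>2) \<le> envelope k"
    by (fact envelope_decrease)
  obtain B where "\<And>k. B \<le> envelope k" using envelope_bounded_below by blast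
  then obtain E where E: "envelope \<longlonglongrightarrow> E"
    using decseq_convergent[OF envelope_decseq] by blast
  have "(\<lambda>k. (envelope k - envelope (Suc k)) / c i) \<longlonglongrightarrow> (E - E) / c i"
    using c[OF assms] by (intro tendsto_intros E LIMSEQ_Suc[OF E]) auto
  then have lim: "(\<lambda>k. (envelope k - envelope (Suc k)) / c i) \<longlonglongrightarrow> 0" by simp
  have le: "(norm (y k - z i k))\<^sup>2 \<le> (envelope k - envelope (Suc k)) / c i" for k
  proof -
    have "c i * (norm (y k - z i k))\<^sup>2 \<le> (\<Sum>i\<in>I. c i * (norm (y k - z i k))\<^sup>2)"
      using c assms finite_index by (intro member_le_sum) (simp_all add: less_imp_le)
    then show ?thesis using decr[of k] c[OF assms] by (simp add: pos_le_divide_eq mult.commute)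
  qed
  have "(\<lambda>k. (norm (y k - z i k))\<^sup>2) \<longlonglongrightarrow> 0"
    by (rule tendsto_sandwich[OF always_eventually[OF allI[OF zero_le_power2]]
          always_eventually[OF allI[OF le]] tendsto_const lim])
  then have "(\<lambda>k. sqrt ((norm (y k - z i k))\<^sup>2)) \<longlonglongrightarrow> sqrt 0" by (rule tendsto_real_sqrt)
  then show ?thesis by (simp add: tendsto_norm_zero_iff)
qed

lemma bounded_z:
  assumes "i \<in> I"
  shows "bounded (range (z i))"
proof -
  have "bounded (range (\<lambda>k. y k - z i k))"
    using residual_tendsto_zero[OF assms] by (rule convergent_imp_bounded)
  from bounded_minus_comp[OF bounded_y this] show ?thesis by simp
qed

lemma bounded_x:
  assumes "i \<in> I"
  shows "bounded (range (x i))"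
proof -
  have "compact (closure (range (z i)))" using bounded_z[OF assms] by simp
  moreover have "continuous_on (closure (range (z i))) (\<lambda>u. u + \<gamma> i *\<^sub>R g i u)"
    using continuous_g[OF assms] by (intro continuous_intros) (blast intro: continuous_on_subset)
  ultimately have "bounded ((\<lambda>u. u + \<gamma> i *\<^sub>R g i u) ` closure (range (z i)))"
    by (intro compact_imp_bounded compact_continuous_image)
  moreover have "range (x i) \<subseteq> (\<lambda>u. u + \<gamma> i *\<^sub>R g i u) ` closure (range (z i))"
    using x_eq[OF assms] closure_subset[of "range (z i)"] by auto
  ultimately show ?thesis by (rule bounded_subset)
qed

section \<open>Stationarity of accumulation points\<close>

text \<open>The residuals vanish, so each \<open>z\<^sub>i\<close> follows \<open>y\<close> to \<open>p\<close>, and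
  \<open>2z\<^sub>i - x\<^sub>i = z\<^sub>i - \<gamma>\<^sub>i g\<^sub>i(z\<^sub>i)\<close> converges by continuity of the gradient.\<close>

lemma center_tendsto:
  assumes "strict_mono r" and y: "(\<lambda>n. y (r n)) \<longlonglongrightarrow> p"
  shows "(\<lambda>n. center (r n)) \<longlonglongrightarrow> p - lam *\<^sub>R (\<Sum>i\<in>I. g i p)"
proof -
  have "(\<lambda>n. lams i *\<^sub>R (2 *\<^sub>R z i (r n) - x i (r n))) \<longlonglongrightarrow> lams i *\<^sub>R p - lam *\<^sub>R g i p"
    if "i \<in> I" for i
  proof -
    have "(\<lambda>n. y (r n) - (y (r n) - z i (r n))) \<longlonglongrightarrow> p - 0"
      using LIMSEQ_subseq_LIMSEQ[OF residual_tendsto_zero[OF that] assms(1)]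
      by (intro tendsto_diff y) (simp add: o_def)
    then have z: "(\<lambda>n. z i (r n)) \<longlonglongrightarrow> p" by simp
    then have "(\<lambda>n. g i (z i (r n))) \<longlonglongrightarrow> g i p"
      using continuous_on_tendsto_compose[OF continuous_g[OF that]] by simp
    with z have "(\<lambda>n. lams i *\<^sub>R (z i (r n) - \<gamma> i *\<^sub>R g i (z i (r n)))) \<longlonglongrightarrow> lams i *\<^sub>R (p - \<gamma> i *\<^sub>R g i p)"
      by (intro tendsto_intros)
    then show ?thesis
      using x_eq[OF that] lams_pos[OF that] by (simp add: scaleR_2 scaleR_diff_right)
  qed
  then have "(\<lambda>n. center (r n)) \<longlonglongrightarrow> (\<Sum>i\<in>I. lams i *\<^sub>R p - lam *\<^sub>R g i p)"
    by (rule tendsto_sum)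
  also have "(\<Sum>i\<in>I. lams i *\<^sub>R p - lam *\<^sub>R g i p) = p - lam *\<^sub>R (\<Sum>i\<in>I. g i p)"
  proof -
    have "(\<Sum>i\<in>I. lams i *\<^sub>R p) = p"
      using scaleR_sum_left[of lams I p] by (simp only: lams_sum scaleR_one)
    then show ?thesis by (simp only: sum_subtractf scaleR_sum_right)
  qed
  finally show ?thesis .
qed

text \<open>The envelope bounds \<open>F (y k)\<close> from above, and lower semicontinuity passes this bound to the limit.\<close>

lemma F_finite_at_limit:
  assumes "(\<lambda>n. y (r n)) \<longlonglongrightarrow> p"
  shows "\<bar>F p\<bar> \<noteq> \<infinity>"
proof -
  obtain A where A: "\<And>k. \<bar>\<Sum>i\<in>I. f i (y k)\<bar> \<le> A"
    using smooth_part_bounded by (auto simp: bounded_iff)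
  have "F p \<noteq> \<infinity>"
  proof
    assume "F p = \<infinity>"
    then have "\<forall>\<^sub>F n in sequentially. ereal (envelope 0 + A) < F (y (r n))"
      by (intro closed_fun_eventually_greater[OF closed assms]) simp
    then obtain n where "envelope 0 + A < Fy (r n)"
      by (auto simp: F_y eventually_sequentially)
    then show False
      using objective_le_envelope[of "r n"] A[of "r n"] by linarith
  qed
  then show ?thesis using proper by (auto simp: proper_fun_def)
qed

text \<open>Lower semicontinuity gives only one half. The other half comes from comparing \<open>y k\<close> with \<open>p\<close> in the
  proximal problem, whose quadratic terms have the same limit at both points.\<close>

lemma F_tendsto:
  assumes "strict_mono r" and y: "(\<lambda>n. y (r n)) \<longlonglongrightarrow> p"
  shows "(\<lambda>n. F (y (r n))) \<longlonglongrightarrow> F p"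
proof -
  obtain b where b: "F p = ereal b" using F_finite_at_limit[OF y] by auto
  define q where "q n = 1 / (2 * lam) * (norm (p - center (r n)))\<^sup>2
      - 1 / (2 * lam) * (norm (y (r n) - center (r n)))\<^sup>2" for n
  define l where "l = p - lam *\<^sub>R (\<Sum>i\<in>I. g i p)"
  have "(\<lambda>n. b + q n) \<longlonglongrightarrow> b + (1 / (2 * lam) * (norm (p - l))\<^sup>2 - 1 / (2 * lam) * (norm (p - l))\<^sup>2)"
    unfolding q_def l_def by (intro tendsto_intros y center_tendsto[OF assms])
  then have lim: "(\<lambda>n. ereal (b + q n)) \<longlonglongrightarrow> F p" using b by simp
  have upper: "F (y (r n)) \<le> ereal (b + q n)" for n
    using prox_le[OF y_step, of "r n" p] b by (simp add: F_y q_def)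
  show ?thesis
  proof (rule order_tendstoI)
    fix c assume "c < F p"
    then show "\<forall>\<^sub>F n in sequentially. c < F (y (r n))"
      by (rule closed_fun_eventually_greater[OF closed y])
  next
    fix c assume "F p < c"
    with lim have "\<forall>\<^sub>F n in sequentially. ereal (b + q n) < c" by (rule order_tendstoD)
    then show "\<forall>\<^sub>F n in sequentially. F (y (r n)) < c"
      by (rule eventually_mono) (use upper le_less_trans in blast)
  qed
qed

lemma accumulation_point_stationary:
  assumes "accumulation_point y p"
  shows "p \<in> zer (\<lambda>u. (\<Sum>i\<in>I. limiting_subdiff (\<lambda>v. ereal (f i v)) u) + limiting_subdiff F u)"
proof -
  obtain r where r: "strict_mono r" and y: "(\<lambda>n. y (r n)) \<longlonglongrightarrow> p"
    using assms by (auto simp: accumulation_point_def o_def)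
  have "(\<lambda>n. (1 / lam) *\<^sub>R (center (r n) - y (r n)))
      \<longlonglongrightarrow> (1 / lam) *\<^sub>R ((p - lam *\<^sub>R (\<Sum>i\<in>I. g i p)) - p)"
    by (intro tendsto_intros y center_tendsto[OF r y])
  then have lim: "(\<lambda>n. (1 / lam) *\<^sub>R (center (r n) - y (r n))) \<longlonglongrightarrow> - (\<Sum>i\<in>I. g i p)"
    using lam_pos by simp
  have sub: "(1 / lam) *\<^sub>R (center (r n) - y (r n)) \<in> frechet_subdiff F (y (r n))" for n
    by (rule prox_imp_frechet_subdiff[OF y_step]) (simp add: F_y)
  have "p \<in> dom_ext F"
    using F_finite_at_limit[OF y] by (auto simp: dom_ext_def)
  then have "- (\<Sum>i\<in>I. g i p) \<in> limiting_subdiff F p"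
    using y F_tendsto[OF r y] lim sub unfolding limiting_subdiff_def by auto
  moreover have "(\<Sum>i\<in>I. g i p) \<in> (\<Sum>i\<in>I. limiting_subdiff (\<lambda>v. ereal (f i v)) p)"
    using gradient lipschitz
    by (intro sum_in_set_sum finite_index gradient_in_limiting_subdiff) auto
  ultimately have "(\<Sum>i\<in>I. g i p) + - (\<Sum>i\<in>I. g i p)
      \<in> (\<Sum>i\<in>I. limiting_subdiff (\<lambda>v. ereal (f i v)) p) + limiting_subdiff F p"
    by (intro set_plus_intro)
  then show ?thesis by (simp add: zer_def)
qed

lemma accumulation_point_z_imp_y:
  assumes "i \<in> I" "accumulation_point (z i) p"
  shows "accumulation_point y p"
proof -
  obtain r where r: "strict_mono r" "(\<lambda>n. z i (r n)) \<longlonglongrightarrow> p"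
    using assms by (auto simp: accumulation_point_def o_def)
  have "(\<lambda>n. (y (r n) - z i (r n)) + z i (r n)) \<longlonglongrightarrow> 0 + p"
    using LIMSEQ_subseq_LIMSEQ[OF residual_tendsto_zero[OF assms(1)] r(1)]
    by (intro tendsto_add r) (simp add: o_def)
  then show ?thesis using r by (auto simp: accumulation_point_def o_def)
qed

end

theorem theorem5p6:
  fixes f :: "nat \<Rightarrow> 'a::euclidean_space \<Rightarrow> real"
    and fm :: "'a \<Rightarrow> ereal"
    and L \<sigma> lams :: "nat \<Rightarrow> real"
    and \<mu> lam :: real
    and m :: nat
    and x z :: "nat \<Rightarrow> nat \<Rightarrow> 'a"
    and y :: "nat \<Rightarrow> 'a"
  assumes m: "m \<ge> 2"
    and L_pos: "\<And>i. i \<in> {1..m-1} \<Longrightarrow> L i > 0"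
    and smooth: "\<And>i. i \<in> {1..m-1} \<Longrightarrow> L_smooth (L i) (f i)"
    and fm_proper: "proper_fun fm"
    and fm_closed: "closed_fun fm"
    and sum_coercive: "coercive (\<lambda>u. (\<Sum>i=1..m-1. ereal (f i u)) + fm u)"
    and mu: "0 < \<mu>" "\<mu> < 2"
    and lam_pos: "lam > 0"
    and lams_pos: "\<And>i. i \<in> {1..m-1} \<Longrightarrow> lams i > 0"
    and lams_sum: "(\<Sum>i=1..m-1. lams i) = 1"
    and sigma_range: "\<And>i. i \<in> {1..m-1} \<Longrightarrow> \<sigma> i \<in> {- L i..0}"
    and sigma_convex: "\<And>i. i \<in> {1..m-1} \<Longrightarrow>
          convex_on UNIV (\<lambda>u. f i u - \<sigma> i / 2 * (norm u)\<^sup>2)"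
    and step_size: "\<And>i. i \<in> {1..m-1} \<Longrightarrow>
          lam / lams i \<in> {0<..<gamma_bar \<mu> (L i) (\<sigma> i)}"
    and z_step: "\<And>i k. i \<in> {1..m-1} \<Longrightarrow>
          z i k \<in> prox (lam / lams i) (\<lambda>u. ereal (f i u)) (x i k)"
    and y_step: "\<And>k. y k \<in> prox lam fm (\<Sum>i=1..m-1. lams i *\<^sub>R (2 *\<^sub>R z i k - x i k))"
    and x_step: "\<And>i k. i \<in> {1..m-1} \<Longrightarrow> x i (Suc k) = x i k + \<mu> *\<^sub>R (y k - z i k)"
  shows "((\<forall>i\<in>{1..m-1}. bounded (range (x i)) \<and> bounded (range (z i))) \<and> bounded (range y)) \<and>
    (\<forall>zstar ystar.
      (\<forall>i\<in>{1..m-1}. accumulation_point (z i) (zstar i)) \<and> accumulation_point y ystar \<longrightarrow>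
      (let Z = zer (\<lambda>u. (\<Sum>i=1..m-1. limiting_subdiff (\<lambda>v. ereal (f i v)) u) + limiting_subdiff fm u)
       in (\<forall>i\<in>{1..m-1}. zstar i \<in> Z) \<and> ystar \<in> Z))"
proof -
  have "\<forall>i\<in>{1..m-1}. \<exists>g. (\<forall>u. GDERIV (f i) u :> g u)
      \<and> (\<forall>u v. norm (g u - g v) \<le> L i * norm (u - v))"
    using smooth unfolding L_smooth_def by blast
  from bchoice[OF this] obtain g where g: "\<And>i u. i \<in> {1..m-1} \<Longrightarrow> GDERIV (f i) u :> g i u"
    "\<And>i u v. i \<in> {1..m-1} \<Longrightarrow> norm (g i u - g i v) \<le> L i * norm (u - v)"
    by blast
  have step: "lam / lams i * L i < 1" "- (lam / lams i * \<sigma> i) < 1 - \<mu> / 2"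
    if "i \<in> {1..m-1}" for i
    by (fact step_size_bounds[OF L_pos[OF that] sigma_range[OF that] mu step_size[OF that]])+
  interpret parallel_douglas_rachford "{1..m-1}" f g L \<sigma> fm lam \<mu> lams x z y
  proof
    show "coercive (\<lambda>u. ereal (\<Sum>i\<in>{1..m-1}. f i u) + fm u)"
      using sum_coercive by simp
    show "\<sigma> i \<le> 0" if "i \<in> {1..m-1}" for i
      using sigma_range[OF that] by simp
  qed (fact finite_atLeastAtMost g L_pos sigma_convex fm_proper fm_closed mu lam_pos lams_pos
      lams_sum step z_step y_step x_step)+
  show ?thesis
    unfolding Let_def
    by (intro conjI ballI allI impI; (elim conjE)?)
      (blast intro: bounded_x bounded_z bounded_y accumulation_point_stationary
        accumulation_point_z_imp_y)+
qed

end
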